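(* Let $R$ be a commutative ring and let $\mathcal{C}({}_R\mathcal{M})$ be the category of chain complexes of finitely generated free $R$-modules. Let $F=(F_\bullet,\tilde d^F_\bullet)$ and $\lambda=(\lambda_\bullet,0)$ be objects of $\mathcal{C}({}_R\mathcal{M})$, where $\lambda$ has all differentials zero. For each $n\in\mathbb{Z}$ let $G_n$ be a submodule of $F_n$ with $F_n=G_n\oplus\operatorname{Im}\tilde d^F_{n-1}$, and let $\alpha=\{\alpha_n:\lambda_n\to F_n\}$ be a morphism from $\lambda$ to $F$ in $\mathcal{C}({}_R\mathcal{M})$ satisfying $\operatorname{Im}\alpha_n\subset G_n$ for each $n\in\mathbb{Z}$. Then each $\lambda_n$ is isomorphic to $H^n(F)=\ker\tilde d^F_n/\operatorname{Im}\tilde d^F_{n-1}$ and each $\alpha_n$ is an injection into $G_n$ if and only if $\operatorname{Cone}(\alpha)\sim 0$.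
   Context: Chain complexes are $\mathbb{Z}$-indexed with differentials $\tilde d^F_n:F_n\to F_{n+1}$, $\tilde d^F_{n+1}\circ\tilde d^F_n=0$; morphisms are chain maps. $\operatorname{Cone}(\alpha)$ is the complex whose $n$-th term is $\lambda_{n+1}\oplus F_n$ with differential $d^Z_n:\lambda_{n+1}\oplus F_n\to\lambda_{n+2}\oplus F_{n+1}$, $d^Z_n(a\oplus x)=0\oplus(\alpha_{n+1}(a)+\tilde d^F_n(x))$. A homotopy from $f$ to $g$ (chain maps $X\to Y$) is a family $\Psi^i:X_i\to Y_{i-1}$ with $f^i-g^i=d_Y^{i-1}\circ\Psi^i+\Psi^{i+1}\circ d_X^i$ for all $i$. $X\sim Y$ means homotopy equivalent: there are chain maps $f:X\to Y$, $g:Y\to X$ with $g\circ f$ homotopic to $id_X$ and $f\circ g$ homotopic to $id_Y$.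
   Formalization: "λ_n is isomorphic to H^n(F)" is read as: the map a ↦ [α_n(a)] induced by α_n is an isomorphism λ_n → H^n(F). With an arbitrary isomorphism the claim fails, e.g. R = F_0 = λ_0 = Z, all other terms zero, α_0 = multiplication by 2. *)

theory Defs
  imports "HOL-Algebra.Module" "HOL-Algebra.AbelCoset"
begin

section \<open>Modules over a commutative ring\<close>

definition mod_hom ::
  "('r, 'm) ring_scheme \<Rightarrow> ('r, 'a) module \<Rightarrow> ('r, 'b) module \<Rightarrow> ('a \<Rightarrow> 'b) set" where
  "mod_hom R M N = {f \<in> carrier M \<rightarrow> carrier N.
     (\<forall>x\<in>carrier M. \<forall>y\<in>carrier M. f (x \<oplus>\<^bsub>M\<^esub> y) = f x \<oplus>\<^bsub>N\<^esub> f y) \<and>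
     (\<forall>r\<in>carrier R. \<forall>x\<in>carrier M. f (r \<odot>\<^bsub>M\<^esub> x) = r \<odot>\<^bsub>N\<^esub> f x)}"

definition mod_iso ::
  "('r, 'm) ring_scheme \<Rightarrow> ('r, 'a) module \<Rightarrow> ('r, 'b) module \<Rightarrow> ('a \<Rightarrow> 'b) set" where
  "mod_iso R M N = {f \<in> mod_hom R M N. bij_betw f (carrier M) (carrier N)}"

definition fg_free :: "('r, 'm) ring_scheme \<Rightarrow> ('r, 'a) module \<Rightarrow> bool" where
  "fg_free R M \<longleftrightarrow> module R M \<and>
     (\<exists>B. finite B \<and> B \<subseteq> carrier M \<and>
        (\<forall>x\<in>carrier M. \<exists>!c. c \<in> B \<rightarrow>\<^sub>E carrier R \<and> x = (\<Oplus>\<^bsub>M\<^esub>b\<in>B. c b \<odot>\<^bsub>M\<^esub> b)))"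

definition is_direct_sum ::
  "('r, 'm) ring_scheme \<Rightarrow> ('r, 'a) module \<Rightarrow> 'a set \<Rightarrow> 'a set \<Rightarrow> bool" where
  "is_direct_sum R M A B \<longleftrightarrow> submodule A R M \<and> submodule B R M \<and>
     A <+>\<^bsub>M\<^esub> B = carrier M \<and> A \<inter> B = {\<zero>\<^bsub>M\<^esub>}"

text \<open>The record type of modules extends that of rings, but the fields \<open>mult\<close> and \<open>one\<close>
  play no role in the locale \<^locale>\<open>module\<close>; they are left unspecified below.\<close>

definition dsum_module :: "('r, 'a) module \<Rightarrow> ('r, 'b) module \<Rightarrow> ('r, 'a \<times> 'b) module" where
  "dsum_module M N =
     \<lparr>carrier = carrier M \<times> carrier N, mult = undefined, one = undefined,
      zero = (\<zero>\<^bsub>M\<^esub>, \<zero>\<^bsub>N\<^esub>),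
      add = (\<lambda>(a, x) (b, y). (a \<oplus>\<^bsub>M\<^esub> b, x \<oplus>\<^bsub>N\<^esub> y)),
      smult = (\<lambda>r (a, x). (r \<odot>\<^bsub>M\<^esub> a, r \<odot>\<^bsub>N\<^esub> x))\<rparr>"

text \<open>The scalar multiple of a coset \<open>N +> x\<close> is \<open>N +> (r \<odot> x)\<close>; the union below
  is over cosets that all coincide when \<open>N\<close> is a submodule.\<close>

definition quot_module :: "('r, 'a) module \<Rightarrow> 'a set \<Rightarrow> ('r, 'a set) module" where
  "quot_module M N =
     \<lparr>carrier = a_rcosets\<^bsub>M\<^esub> N, mult = undefined, one = undefined,
      zero = N,
      add = (\<lambda>X Y. X <+>\<^bsub>M\<^esub> Y),
      smult = (\<lambda>r X. \<Union>x\<in>X. N +>\<^bsub>M\<^esub> (r \<odot>\<^bsub>M\<^esub> x))\<rparr>"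


section \<open>Complexes of finitely generated free modules\<close>

record ('r, 'a) cx =
  obj :: "int \<Rightarrow> ('r, 'a) module"
  dif :: "int \<Rightarrow> 'a \<Rightarrow> 'a"

definition fg_free_cx :: "('r, 'm) ring_scheme \<Rightarrow> ('r, 'a) cx \<Rightarrow> bool" where
  "fg_free_cx R X \<longleftrightarrow>
     (\<forall>n. fg_free R (obj X n)) \<and>
     (\<forall>n. dif X n \<in> mod_hom R (obj X n) (obj X (n + 1))) \<and>
     (\<forall>n. \<forall>x\<in>carrier (obj X n). dif X (n + 1) (dif X n x) = \<zero>\<^bsub>obj X (n + 2)\<^esub>)"

definition chain_map ::
  "('r, 'm) ring_scheme \<Rightarrow> ('r, 'a) cx \<Rightarrow> ('r, 'b) cx \<Rightarrow> (int \<Rightarrow> 'a \<Rightarrow> 'b) \<Rightarrow> bool" where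
  "chain_map R X Y f \<longleftrightarrow>
     (\<forall>n. f n \<in> mod_hom R (obj X n) (obj Y n)) \<and>
     (\<forall>n. \<forall>x\<in>carrier (obj X n). f (n + 1) (dif X n x) = dif Y n (f n x))"

definition homotopic ::
  "('r, 'm) ring_scheme \<Rightarrow> ('r, 'a) cx \<Rightarrow> ('r, 'b) cx \<Rightarrow>
     (int \<Rightarrow> 'a \<Rightarrow> 'b) \<Rightarrow> (int \<Rightarrow> 'a \<Rightarrow> 'b) \<Rightarrow> bool" where
  "homotopic R X Y f g \<longleftrightarrow>
     (\<exists>\<Psi>. (\<forall>i. \<Psi> i \<in> mod_hom R (obj X i) (obj Y (i - 1))) \<and>
          (\<forall>i. \<forall>x\<in>carrier (obj X i).
             f i x \<ominus>\<^bsub>obj Y i\<^esub> g i x =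
             dif Y (i - 1) (\<Psi> i x) \<oplus>\<^bsub>obj Y i\<^esub> \<Psi> (i + 1) (dif X i x)))"

definition homotopy_equiv ::
  "('r, 'm) ring_scheme \<Rightarrow> ('r, 'a) cx \<Rightarrow> ('r, 'b) cx \<Rightarrow> bool" where
  "homotopy_equiv R X Y \<longleftrightarrow>
     (\<exists>f g. chain_map R X Y f \<and> chain_map R Y X g \<and>
        homotopic R X X (\<lambda>n. g n \<circ> f n) (\<lambda>n. id) \<and>
        homotopic R Y Y (\<lambda>n. f n \<circ> g n) (\<lambda>n. id))"

definition zero_cx :: "('r, unit) cx" where
  "zero_cx =
     \<lparr>obj = (\<lambda>n. \<lparr>carrier = {()}, mult = undefined, one = undefined, zero = (),
                    add = (\<lambda>_ _. ()), smult = (\<lambda>_ _. ())\<rparr>),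
      dif = (\<lambda>n x. x)\<rparr>"

definition boundaries :: "('r, 'a) cx \<Rightarrow> int \<Rightarrow> 'a set" where
  "boundaries X n = dif X (n - 1) ` carrier (obj X (n - 1))"

definition cohomology :: "('r, 'a) cx \<Rightarrow> int \<Rightarrow> ('r, 'a set) module" where
  "cohomology X n =
     quot_module ((obj X n)\<lparr>carrier := a_kernel (obj X n) (obj X (n + 1)) (dif X n)\<rparr>)
       (boundaries X n)"

text \<open>The map \<open>L\<^sub>n \<rightarrow> H\<^sup>n(X)\<close>, \<open>a \<mapsto> [\<alpha>\<^sub>n(a)]\<close> induced by a chain map \<open>\<alpha>\<close>
  from a complex with zero differential. It is this map, not merely some map, that has to be
  an isomorphism: for multiplication by 2 on the integers in degree 0, both modules are
  isomorphic and \<open>\<alpha>\<close> is injective, but the cone is not contractible.\<close>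

definition class_map :: "('r, 'b) cx \<Rightarrow> (int \<Rightarrow> 'a \<Rightarrow> 'b) \<Rightarrow> int \<Rightarrow> 'a \<Rightarrow> 'b set" where
  "class_map X \<alpha> n a = boundaries X n +>\<^bsub>obj X n\<^esub> \<alpha> n a"

text \<open>The cone of \<open>\<alpha> : L \<rightarrow> F\<close>, only meant for \<open>L\<close> with zero differential: there is no
  contribution of the differential of \<open>L\<close> in the first component.\<close>

definition cone ::
  "('r, 'a) cx \<Rightarrow> ('r, 'b) cx \<Rightarrow> (int \<Rightarrow> 'a \<Rightarrow> 'b) \<Rightarrow> ('r, 'a \<times> 'b) cx" where
  "cone L F \<alpha> =
     \<lparr>obj = (\<lambda>n. dsum_module (obj L (n + 1)) (obj F n)),
      dif = (\<lambda>n (a, x). (\<zero>\<^bsub>obj L (n + 2)\<^esub>,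
                          \<alpha> (n + 1) a \<oplus>\<^bsub>obj F (n + 1)\<^esub> dif F n x))\<rparr>"

end

theory Submission
  imports Defs
begin

text \<open>
  A contraction makes the cone acyclic. Acyclicity on the pairs \<open>(0, x)\<close> with \<open>x\<close> a cycle says
  that \<open>\<alpha>\<close> hits every cohomology class, and on the pairs \<open>(a, y)\<close> with \<open>\<alpha> a + d y = 0\<close> that only
  \<open>a = 0\<close> is sent to a boundary.

  Conversely, let \<open>p\<close> be the projection of \<open>F\<^sub>n\<close> onto the boundaries along \<open>G\<^sub>n\<close>. Since \<open>F\<^sub>n\<close> is
  free and \<open>d\<close> maps \<open>G\<^sub>n\<^sub>-\<^sub>1\<close> onto the boundaries, \<open>p\<close> lifts through \<open>d\<close> to a map
  \<open>s : F\<^sub>n \<rightarrow> G\<^sub>n\<^sub>-\<^sub>1\<close> vanishing on \<open>G\<^sub>n\<close>. Then \<open>w x = x - p x - s (d x)\<close> is a cycle in \<open>G\<^sub>n\<close>, and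
  such cycles are exactly the image of \<open>\<alpha>\<close>, so \<open>w = \<alpha> \<circ> q\<close> for some \<open>q\<close>. The map
  \<open>(a, x) \<mapsto> (q x, s x)\<close> contracts the cone.
\<close>

section \<open>Module homomorphisms\<close>

lemma (in abelian_group) a_minus_zero: "x \<in> carrier G \<Longrightarrow> x \<ominus> \<zero> = x"
  by (metis a_minus_def minus_equality r_zero zero_closed)

lemma (in abelian_group) minus_eq_zero_iff:
  assumes "x \<in> carrier G" "y \<in> carrier G"
  shows "x \<ominus> y = \<zero> \<longleftrightarrow> x = y"
proof
  assume "x \<ominus> y = \<zero>"
  then have "(x \<ominus> y) \<oplus> y = y" using assms by simp
  then show "x = y" using assms by (simp add: a_minus_def a_assoc l_neg)
qed (use assms in \<open>simp add: a_minus_def r_neg\<close>)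

lemma mod_homI:
  assumes "\<And>x. x \<in> carrier M \<Longrightarrow> f x \<in> carrier N"
    and "\<And>x y. x \<in> carrier M \<Longrightarrow> y \<in> carrier M \<Longrightarrow> f (x \<oplus>\<^bsub>M\<^esub> y) = f x \<oplus>\<^bsub>N\<^esub> f y"
    and "\<And>r x. r \<in> carrier R \<Longrightarrow> x \<in> carrier M \<Longrightarrow> f (r \<odot>\<^bsub>M\<^esub> x) = r \<odot>\<^bsub>N\<^esub> f x"
  shows "f \<in> mod_hom R M N"
  using assms by (simp add: mod_hom_def)

lemma mod_hom_closed: "f \<in> mod_hom R M N \<Longrightarrow> x \<in> carrier M \<Longrightarrow> f x \<in> carrier N"
  by (auto simp: mod_hom_def)

lemma mod_hom_add:
  "f \<in> mod_hom R M N \<Longrightarrow> x \<in> carrier M \<Longrightarrow> y \<in> carrier M \<Longrightarrow> f (x \<oplus>\<^bsub>M\<^esub> y) = f x \<oplus>\<^bsub>N\<^esub> f y"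
  by (simp add: mod_hom_def)

lemma mod_hom_smult:
  "f \<in> mod_hom R M N \<Longrightarrow> r \<in> carrier R \<Longrightarrow> x \<in> carrier M \<Longrightarrow> f (r \<odot>\<^bsub>M\<^esub> x) = r \<odot>\<^bsub>N\<^esub> f x"
  by (simp add: mod_hom_def)

lemma mod_hom_abelian_group_hom:
  assumes "module R M" "module R N" "f \<in> mod_hom R M N"
  shows "abelian_group_hom M N f"
proof -
  interpret M: module R M by fact
  interpret N: module R N by fact
  show ?thesis
    using assms(3) by (intro abelian_group_homI M.abelian_group_axioms N.abelian_group_axioms)
      (auto simp: mod_hom_def hom_def Pi_iff group_hom_def group_hom_axioms_def M.a_group N.a_group)
qed

lemma mod_hom_zero:
  assumes "module R M" "module R N" "f \<in> mod_hom R M N"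
  shows "f \<zero>\<^bsub>M\<^esub> = \<zero>\<^bsub>N\<^esub>"
  by (rule abelian_group_hom.hom_zero[OF mod_hom_abelian_group_hom[OF assms]])

lemma mod_hom_a_inv:
  assumes "module R M" "module R N" "f \<in> mod_hom R M N" "x \<in> carrier M"
  shows "f (\<ominus>\<^bsub>M\<^esub> x) = \<ominus>\<^bsub>N\<^esub> f x"
  by (rule abelian_group_hom.hom_a_inv[OF mod_hom_abelian_group_hom[OF assms(1-3)] assms(4)])

lemma mod_hom_minus:
  assumes "module R M" "module R N" "f \<in> mod_hom R M N" "x \<in> carrier M" "y \<in> carrier M"
  shows "f (x \<ominus>\<^bsub>M\<^esub> y) = f x \<ominus>\<^bsub>N\<^esub> f y"
proof -
  interpret M: module R M by fact
  show ?thesis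
    using assms by (simp add: a_minus_def mod_hom_add mod_hom_a_inv)
qed

lemma mod_hom_finsum:
  assumes "module R M" "module R N" "f \<in> mod_hom R M N" "finite A" "g \<in> A \<rightarrow> carrier M"
  shows "f (\<Oplus>\<^bsub>M\<^esub>i\<in>A. g i) = (\<Oplus>\<^bsub>N\<^esub>i\<in>A. f (g i))"
proof -
  interpret M: module R M by fact
  interpret N: module R N by fact
  show ?thesis
    using assms(4,5)
  proof (induction A)
    case empty
    then show ?case by (simp add: mod_hom_zero[OF assms(1-3)])
  next
    case (insert a A)
    then have g: "g \<in> A \<rightarrow> carrier M" "g a \<in> carrier M" by auto
    moreover from g have "(\<lambda>i. f (g i)) \<in> A \<rightarrow> carrier N" "f (g a) \<in> carrier N"
      using mod_hom_closed[OF assms(3)] by auto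
    ultimately show ?case
      using insert by (simp add: mod_hom_add[OF assms(3)])
  qed
qed

lemma mod_hom_id: "(\<lambda>x. x) \<in> mod_hom R M M"
  by (simp add: mod_hom_def)

lemma mod_hom_compose:
  "f \<in> mod_hom R M N \<Longrightarrow> g \<in> mod_hom R N P \<Longrightarrow> (\<lambda>x. g (f x)) \<in> mod_hom R M P"
  by (auto simp: mod_hom_def Pi_iff)

lemma mod_hom_diff:
  assumes "module R M" "module R N" "f \<in> mod_hom R M N" "g \<in> mod_hom R M N"
  shows "(\<lambda>x. f x \<ominus>\<^bsub>N\<^esub> g x) \<in> mod_hom R M N"
proof -
  interpret M: module R M by fact
  interpret N: module R N by fact
  note cl = mod_hom_closed[OF assms(3)] mod_hom_closed[OF assms(4)]
  show ?thesis
  proof (rule mod_homI)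
    fix x y assume xy: "x \<in> carrier M" "y \<in> carrier M"
    then show "f (x \<oplus>\<^bsub>M\<^esub> y) \<ominus>\<^bsub>N\<^esub> g (x \<oplus>\<^bsub>M\<^esub> y) = f x \<ominus>\<^bsub>N\<^esub> g x \<oplus>\<^bsub>N\<^esub> (f y \<ominus>\<^bsub>N\<^esub> g y)"
      using assms(3,4) cl by (simp add: mod_hom_add a_minus_def N.minus_add N.a_ac)
  next
    fix r x assume "r \<in> carrier R" "x \<in> carrier M"
    then show "f (r \<odot>\<^bsub>M\<^esub> x) \<ominus>\<^bsub>N\<^esub> g (r \<odot>\<^bsub>M\<^esub> x) = r \<odot>\<^bsub>N\<^esub> (f x \<ominus>\<^bsub>N\<^esub> g x)"
      using assms(3,4) cl
      by (simp add: mod_hom_smult a_minus_def N.smult_r_distr N.smult_r_minus)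
  qed (use cl in auto)
qed

lemma mod_hom_neg:
  assumes "module R M" "module R N" "f \<in> mod_hom R M N"
  shows "(\<lambda>x. \<ominus>\<^bsub>N\<^esub> f x) \<in> mod_hom R M N"
proof -
  interpret N: module R N by fact
  \<comment> \<open>Negation is obtained as the difference of the zero map and \<open>f\<close>. The
    functions \<open>0 - f\<close> and \<open>- f\<close> agree only on the carrier, so the result
    is transferred pointwise through the definition of \<open>mod_hom\<close>.\<close>
  have "(\<lambda>x. \<zero>\<^bsub>N\<^esub>) \<in> mod_hom R M N"
    by (rule mod_homI) auto
  from mod_hom_diff[OF assms(1,2) this assms(3)]
  have "(\<lambda>x. \<zero>\<^bsub>N\<^esub> \<ominus>\<^bsub>N\<^esub> f x) \<in> mod_hom R M N" .
  moreover have "\<zero>\<^bsub>N\<^esub> \<ominus>\<^bsub>N\<^esub> f x = \<ominus>\<^bsub>N\<^esub> f x" if "x \<in> carrier M" for x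
    using mod_hom_closed[OF assms(3) that] by (simp add: a_minus_def)
  ultimately show ?thesis
    using module.axioms(2)[OF assms(1)] module.smult_closed[OF assms(1)]
    by (auto simp: mod_hom_def Pi_iff abelian_groupE(1))
qed

lemma mod_hom_kernel_submodule:
  assumes "module R M" "module R N" "f \<in> mod_hom R M N"
  shows "submodule (a_kernel M N f) R M"
proof -
  interpret M: module R M by fact
  interpret N: module R N by fact
  show ?thesis
    using assms
    by (intro M.submoduleI) (auto simp: a_kernel_def' mod_hom_zero mod_hom_a_inv mod_hom_add mod_hom_smult)
qed

text \<open>The complement \<open>A\<close> makes the \<open>B\<close>-component of each element
  unique, since two candidates differ by an element of both \<open>A\<close> and \<open>B\<close>.
  Linearity of the component map then follows from uniqueness alone.\<close>

lemma direct_sum_projection: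
  assumes M: "module R M" and AB: "is_direct_sum R M A B"
  obtains p where "p \<in> mod_hom R M M"
    and "\<And>x. x \<in> carrier M \<Longrightarrow> p x \<in> B"
    and "\<And>x. x \<in> carrier M \<Longrightarrow> x \<ominus>\<^bsub>M\<^esub> p x \<in> A"
    and "\<And>x. x \<in> A \<Longrightarrow> p x = \<zero>\<^bsub>M\<^esub>"
    and "\<And>x. x \<in> B \<Longrightarrow> p x = x"
proof -
  interpret M: module R M by fact
  have A: "submodule A R M" and B: "submodule B R M"
    and sum: "A <+>\<^bsub>M\<^esub> B = carrier M" and int: "A \<inter> B = {\<zero>\<^bsub>M\<^esub>}"
    using AB by (auto simp: is_direct_sum_def)
  note Ae = M.submoduleE[OF A] and Be = M.submoduleE[OF B]
  \<comment> \<open>The difference \<open>b' - b\<close> lies in \<open>B\<close> directly, and in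
    \<open>A\<close> because it equals \<open>(x - b) - (x - b')\<close>.\<close>
  have uniq: "b = b'" if "x \<in> carrier M" "b \<in> B" "b' \<in> B" "x \<ominus>\<^bsub>M\<^esub> b \<in> A" "x \<ominus>\<^bsub>M\<^esub> b' \<in> A" for x b b'
  proof -
    have c: "b \<in> carrier M" "b' \<in> carrier M" using that Be(1) by auto
    have "b' \<ominus>\<^bsub>M\<^esub> b = b' \<oplus>\<^bsub>M\<^esub> (\<ominus>\<^bsub>M\<^esub> x \<oplus>\<^bsub>M\<^esub> (x \<oplus>\<^bsub>M\<^esub> \<ominus>\<^bsub>M\<^esub> b))"
      using c that(1) by (simp add: a_minus_def M.r_neg1)
    also have "\<dots> = (x \<ominus>\<^bsub>M\<^esub> b) \<ominus>\<^bsub>M\<^esub> (x \<ominus>\<^bsub>M\<^esub> b')"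
      using c that(1) by (simp add: a_minus_def M.minus_add M.a_ac)
    finally have "b' \<ominus>\<^bsub>M\<^esub> b = (x \<ominus>\<^bsub>M\<^esub> b) \<ominus>\<^bsub>M\<^esub> (x \<ominus>\<^bsub>M\<^esub> b')" .
    then have "b' \<ominus>\<^bsub>M\<^esub> b \<in> A" using that Ae(3,5) by (simp add: a_minus_def)
    moreover have "b' \<ominus>\<^bsub>M\<^esub> b \<in> B" using that Be(3,5) by (simp add: a_minus_def)
    ultimately have "b' \<ominus>\<^bsub>M\<^esub> b = \<zero>\<^bsub>M\<^esub>" using int by blast
    then show ?thesis using c by (simp add: M.minus_eq_zero_iff)
  qed
  have ex: "\<exists>b. b \<in> B \<and> x \<ominus>\<^bsub>M\<^esub> b \<in> A" if "x \<in> carrier M" for x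
  proof -
    obtain a b where ab: "a \<in> A" "b \<in> B" "x = a \<oplus>\<^bsub>M\<^esub> b"
      using \<open>x \<in> carrier M\<close> unfolding sum[symmetric] set_add_def' by blast
    then have "a \<in> carrier M" "b \<in> carrier M" using Ae(1) Be(1) by auto
    then have "x \<ominus>\<^bsub>M\<^esub> b = a" using ab by (simp add: a_minus_def M.a_assoc M.r_neg)
    then show ?thesis using ab by blast
  qed
  define p where "p x = (SOME b. b \<in> B \<and> x \<ominus>\<^bsub>M\<^esub> b \<in> A)" for x
  have pB: "p x \<in> B" and pA: "x \<ominus>\<^bsub>M\<^esub> p x \<in> A" if "x \<in> carrier M" for x
    using someI_ex[OF ex[OF that]] by (auto simp: p_def)
  \<comment> \<open>This characterisation is what every later equation about \<open>p\<close> uses: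
    it suffices to exhibit a value in \<open>B\<close> whose difference from the argument lies in
    \<open>A\<close>.\<close>
  have eq: "p x = b" if "x \<in> carrier M" "b \<in> B" "x \<ominus>\<^bsub>M\<^esub> b \<in> A" for x b
    using uniq that pA pB by blast
  have pc: "p x \<in> carrier M" if "x \<in> carrier M" for x
    using pB[OF that] Be(1) by auto
  have "p \<in> mod_hom R M M"
  proof (rule mod_homI)
    fix x y assume xy: "x \<in> carrier M" "y \<in> carrier M"
    have "x \<oplus>\<^bsub>M\<^esub> y \<ominus>\<^bsub>M\<^esub> (p x \<oplus>\<^bsub>M\<^esub> p y) = (x \<ominus>\<^bsub>M\<^esub> p x) \<oplus>\<^bsub>M\<^esub> (y \<ominus>\<^bsub>M\<^esub> p y)"
      using xy pc by (simp add: a_minus_def M.minus_add M.a_ac)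
    then show "p (x \<oplus>\<^bsub>M\<^esub> y) = p x \<oplus>\<^bsub>M\<^esub> p y"
      using xy pA pB Ae(5) Be(5) by (intro eq) auto
  next
    fix r x assume rx: "r \<in> carrier R" "x \<in> carrier M"
    have "r \<odot>\<^bsub>M\<^esub> x \<ominus>\<^bsub>M\<^esub> r \<odot>\<^bsub>M\<^esub> p x = r \<odot>\<^bsub>M\<^esub> (x \<ominus>\<^bsub>M\<^esub> p x)"
      using rx pc by (simp add: a_minus_def M.smult_r_distr M.smult_r_minus)
    then show "p (r \<odot>\<^bsub>M\<^esub> x) = r \<odot>\<^bsub>M\<^esub> p x"
      using rx pA pB Ae(4) Be(4) by (intro eq) auto
  qed (rule pc)
  moreover have "p x = \<zero>\<^bsub>M\<^esub>" if "x \<in> A" for x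
  proof (rule eq)
    show "x \<in> carrier M" using that Ae(1) by auto
    then show "x \<ominus>\<^bsub>M\<^esub> \<zero>\<^bsub>M\<^esub> \<in> A"
      using that by (simp add: M.a_minus_zero)
  qed (use int in auto)
  moreover have "p x = x" if "x \<in> B" for x
  proof (rule eq)
    show "x \<in> carrier M" using that Be(1) by auto
    then show "x \<ominus>\<^bsub>M\<^esub> x \<in> A" using int by (auto simp: a_minus_def M.r_neg)
  qed (rule that)
  ultimately show thesis using that pA pB by blast
qed

text \<open>Free modules are projective: choose preimages of the images of the basis and extend
  linearly. Asking only that the image of \<open>f\<close> lie in that of \<open>g\<close>, instead
  of surjectivity of \<open>g\<close>, lets the lemma lift through the differential of
  \<open>F\<close> and through \<alpha>.\<close>

lemma fg_free_lift:
  assumes P: "fg_free R P" and M: "module R M" and N: "module R N"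
    and f: "f \<in> mod_hom R P M" and g: "g \<in> mod_hom R N M"
    and sub: "f ` carrier P \<subseteq> g ` carrier N"
  obtains h where "h \<in> mod_hom R P N" and "\<And>x. x \<in> carrier P \<Longrightarrow> g (h x) = f x"
proof -
  have "module R P" using P by (simp add: fg_free_def)
  interpret P: module R P by fact
  interpret M: module R M by fact
  interpret N: module R N by fact
  obtain B where B: "finite B" "B \<subseteq> carrier P"
    and basis: "\<And>x. x \<in> carrier P \<Longrightarrow> \<exists>!c. c \<in> B \<rightarrow>\<^sub>E carrier R \<and> x = (\<Oplus>\<^bsub>P\<^esub>b\<in>B. c b \<odot>\<^bsub>P\<^esub> b)"
    using P by (auto simp: fg_free_def)
  have "\<forall>b\<in>B. \<exists>y\<in>carrier N. g y = f b"
    using B(2) sub by (metis image_eqI subsetD imageE)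
  then obtain y where y: "\<And>b. b \<in> B \<Longrightarrow> y b \<in> carrier N" and gy: "\<And>b. b \<in> B \<Longrightarrow> g (y b) = f b"
    by metis
  \<comment> \<open>The coordinates of \<open>x\<close> in the basis \<open>B\<close>;
    extensionality of the coefficient functions outside \<open>B\<close> is what makes them unique
    as functions.\<close>
  define c where "c x = (THE c. c \<in> B \<rightarrow>\<^sub>E carrier R \<and> x = (\<Oplus>\<^bsub>P\<^esub>b\<in>B. c b \<odot>\<^bsub>P\<^esub> b))" for x
  have cR: "c x \<in> B \<rightarrow>\<^sub>E carrier R" and cx: "x = (\<Oplus>\<^bsub>P\<^esub>b\<in>B. c x b \<odot>\<^bsub>P\<^esub> b)" if "x \<in> carrier P" for x
    using theI'[OF basis[OF that]] by (auto simp: c_def)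
  have cin: "c x b \<in> carrier R" if "x \<in> carrier P" "b \<in> B" for x b
    using cR[OF that(1)] that(2) by auto
  \<comment> \<open>Sums and multiples of coordinate functions need not be extensional, so
    uniqueness is applied to their restriction to \<open>B\<close>. Linearity of the coordinates,
    and hence of \<open>h\<close>, rests on this.\<close>
  have ceq: "c x b = c' b" if "c' \<in> B \<rightarrow> carrier R" "x = (\<Oplus>\<^bsub>P\<^esub>b\<in>B. c' b \<odot>\<^bsub>P\<^esub> b)" "b \<in> B" for x c' b
  proof -
    have x: "x \<in> carrier P" using that(1) B(2) unfolding that(2)
      by (intro P.finsum_closed) (auto simp: Pi_iff subset_iff)
    have "x = (\<Oplus>\<^bsub>P\<^esub>b\<in>B. restrict c' B b \<odot>\<^bsub>P\<^esub> b)"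
      unfolding that(2) using that(1) B(2) by (intro P.finsum_cong') (auto simp: Pi_iff subset_iff)
    then have "c x = restrict c' B"
      unfolding c_def using that(1) by (intro the1_equality basis x) auto
    then show ?thesis using that(3) by simp
  qed
  define h where "h x = (\<Oplus>\<^bsub>N\<^esub>b\<in>B. c x b \<odot>\<^bsub>N\<^esub> y b)" for x
  have "h \<in> mod_hom R P N"
  proof (rule mod_homI)
    fix x assume "x \<in> carrier P"
    then show "h x \<in> carrier N"
      unfolding h_def using cin y by (intro N.finsum_closed) auto
  next
    fix x x' assume xx: "x \<in> carrier P" "x' \<in> carrier P"
    have "x \<oplus>\<^bsub>P\<^esub> x' = (\<Oplus>\<^bsub>P\<^esub>b\<in>B. c x b \<odot>\<^bsub>P\<^esub> b) \<oplus>\<^bsub>P\<^esub> (\<Oplus>\<^bsub>P\<^esub>b\<in>B. c x' b \<odot>\<^bsub>P\<^esub> b)"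
      using cx xx by simp
    also have "\<dots> = (\<Oplus>\<^bsub>P\<^esub>b\<in>B. c x b \<odot>\<^bsub>P\<^esub> b \<oplus>\<^bsub>P\<^esub> c x' b \<odot>\<^bsub>P\<^esub> b)"
      using cin xx B(2) by (intro P.finsum_addf[symmetric]) auto
    also have "\<dots> = (\<Oplus>\<^bsub>P\<^esub>b\<in>B. (c x b \<oplus>\<^bsub>R\<^esub> c x' b) \<odot>\<^bsub>P\<^esub> b)"
      using cin xx B(2) by (intro P.finsum_cong') (auto simp: P.smult_l_distr subset_iff)
    finally have "c (x \<oplus>\<^bsub>P\<^esub> x') b = c x b \<oplus>\<^bsub>R\<^esub> c x' b" if "b \<in> B" for b
      using that cin xx by (intro ceq) auto
    then have "h (x \<oplus>\<^bsub>P\<^esub> x') = (\<Oplus>\<^bsub>N\<^esub>b\<in>B. c x b \<odot>\<^bsub>N\<^esub> y b \<oplus>\<^bsub>N\<^esub> c x' b \<odot>\<^bsub>N\<^esub> y b)"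
      unfolding h_def using cin y xx by (intro N.finsum_cong') (auto simp: N.smult_l_distr)
    also have "\<dots> = h x \<oplus>\<^bsub>N\<^esub> h x'"
      unfolding h_def using cin y xx by (intro N.finsum_addf) auto
    finally show "h (x \<oplus>\<^bsub>P\<^esub> x') = h x \<oplus>\<^bsub>N\<^esub> h x'" .
  next
    fix r x assume rx: "r \<in> carrier R" "x \<in> carrier P"
    have "r \<odot>\<^bsub>P\<^esub> x = r \<odot>\<^bsub>P\<^esub> (\<Oplus>\<^bsub>P\<^esub>b\<in>B. c x b \<odot>\<^bsub>P\<^esub> b)"
      using cx rx by simp
    also have "\<dots> = (\<Oplus>\<^bsub>P\<^esub>b\<in>B. r \<odot>\<^bsub>P\<^esub> (c x b \<odot>\<^bsub>P\<^esub> b))"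
      using cin rx B by (intro P.finsum_smult_ldistr) auto
    also have "\<dots> = (\<Oplus>\<^bsub>P\<^esub>b\<in>B. (r \<otimes>\<^bsub>R\<^esub> c x b) \<odot>\<^bsub>P\<^esub> b)"
      using cin rx B(2) by (intro P.finsum_cong') (auto simp: P.smult_assoc1 subset_iff)
    finally have "c (r \<odot>\<^bsub>P\<^esub> x) b = r \<otimes>\<^bsub>R\<^esub> c x b" if "b \<in> B" for b
      using that cin rx by (intro ceq) auto
    then have "h (r \<odot>\<^bsub>P\<^esub> x) = (\<Oplus>\<^bsub>N\<^esub>b\<in>B. r \<odot>\<^bsub>N\<^esub> (c x b \<odot>\<^bsub>N\<^esub> y b))"
      unfolding h_def using cin y rx by (intro N.finsum_cong') (auto simp: N.smult_assoc1)
    also have "\<dots> = r \<odot>\<^bsub>N\<^esub> h x"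
      unfolding h_def using cin y rx B by (intro N.finsum_smult_ldistr[symmetric]) auto
    finally show "h (r \<odot>\<^bsub>P\<^esub> x) = r \<odot>\<^bsub>N\<^esub> h x" .
  qed
  moreover have "g (h x) = f x" if x: "x \<in> carrier P" for x
  proof -
    have "g (h x) = (\<Oplus>\<^bsub>M\<^esub>b\<in>B. g (c x b \<odot>\<^bsub>N\<^esub> y b))"
      unfolding h_def using cin y x B by (intro mod_hom_finsum[OF N M g]) auto
    also have "\<dots> = (\<Oplus>\<^bsub>M\<^esub>b\<in>B. f (c x b \<odot>\<^bsub>P\<^esub> b))"
      using cin y x B gy mod_hom_closed[OF f]
      by (intro M.finsum_cong') (auto simp: mod_hom_smult[OF f] mod_hom_smult[OF g] subset_iff)
    also have "\<dots> = f (\<Oplus>\<^bsub>P\<^esub>b\<in>B. c x b \<odot>\<^bsub>P\<^esub> b)"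
      using cin x B by (intro mod_hom_finsum[OF \<open>module R P\<close> M f, symmetric]) auto
    also have "\<dots> = f x" using cx[OF x] by simp
    finally show ?thesis .
  qed
  ultimately show thesis using that by blast
qed

text \<open>Composing \<open>f\<close> with the quotient map always gives a homomorphism, so only
  bijectivity is at stake: trivial kernel is the first condition, and representing every coset of
  \<open>B\<close> in \<open>K\<close> is the second. This turns the cohomology condition into
  statements about elements.\<close>

lemma quotient_map_mod_iso_iff:
  assumes L: "module R L" and M: "module R M"
    and K: "submodule K R M" and B: "submodule B R M" and "B \<subseteq> K"
    and f: "f \<in> mod_hom R L M" and fK: "f ` carrier L \<subseteq> K"
  shows "(\<lambda>a. B +>\<^bsub>M\<^esub> f a) \<in> mod_iso R L (quot_module (M\<lparr>carrier := K\<rparr>) B) \<longleftrightarrow>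
    (\<forall>a\<in>carrier L. f a \<in> B \<longrightarrow> a = \<zero>\<^bsub>L\<^esub>) \<and>
    (\<forall>x\<in>K. \<exists>a\<in>carrier L. \<exists>b\<in>B. x = b \<oplus>\<^bsub>M\<^esub> f a)" (is "?q \<in> mod_iso R L ?Q \<longleftrightarrow> _")
proof -
  interpret L: module R L by fact
  interpret M: module R M by fact
  note Be = M.submoduleE[OF B] and Ke = M.submoduleE[OF K]
  have Bsub: "subgroup B (add_monoid M)" using B by (rule submodule.axioms)
  interpret B: abelian_subgroup B M
    using Bsub by (intro abelian_subgroupI3 additive_subgroupI M.abelian_group_axioms)
  have fc: "f a \<in> carrier M" if "a \<in> carrier L" for a using mod_hom_closed[OF f that] .
  \<comment> \<open>Restricting the carrier to \<open>K\<close> leaves addition unchanged, so cosets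
    may be computed in \<open>M\<close>.\<close>
  have coset: "B +>\<^bsub>M\<lparr>carrier := K\<rparr>\<^esub> x = B +>\<^bsub>M\<^esub> x" for x
    by (simp add: a_r_coset_def')
  have carr: "carrier ?Q = (\<lambda>x. B +>\<^bsub>M\<^esub> x) ` K"
    by (auto simp: quot_module_def A_RCOSETS_def' coset)
  have eq_iff: "B +>\<^bsub>M\<^esub> x = B +>\<^bsub>M\<^esub> y \<longleftrightarrow> x \<ominus>\<^bsub>M\<^esub> y \<in> B"
    if "x \<in> carrier M" "y \<in> carrier M" for x y
  proof
    assume "B +>\<^bsub>M\<^esub> x = B +>\<^bsub>M\<^esub> y"
    then have "x \<in> B +>\<^bsub>M\<^esub> y" using B.a_rcos_self[OF that(1)] by simp
    then show "x \<ominus>\<^bsub>M\<^esub> y \<in> B" using that by (simp add: B.a_rcos_module_imp a_minus_def)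
  next
    assume "x \<ominus>\<^bsub>M\<^esub> y \<in> B"
    then have "x \<in> B +>\<^bsub>M\<^esub> y" using that by (simp add: B.a_rcos_module_rev a_minus_def)
    then show "B +>\<^bsub>M\<^esub> x = B +>\<^bsub>M\<^esub> y" using M.a_repr_independence[OF _ that(2) Bsub] by simp
  qed
  have hom: "?q \<in> mod_hom R L ?Q"
  proof (rule mod_homI)
    fix a assume "a \<in> carrier L"
    then show "B +>\<^bsub>M\<^esub> f a \<in> carrier ?Q" using fK carr by auto
  next
    fix a b assume ab: "a \<in> carrier L" "b \<in> carrier L"
    have "B +>\<^bsub>M\<^esub> f (a \<oplus>\<^bsub>L\<^esub> b) = (B +>\<^bsub>M\<^esub> f a) <+>\<^bsub>M\<^esub> (B +>\<^bsub>M\<^esub> f b)"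
      using ab fc by (simp add: mod_hom_add[OF f] B.a_rcos_sum)
    then show "B +>\<^bsub>M\<^esub> f (a \<oplus>\<^bsub>L\<^esub> b) = (B +>\<^bsub>M\<^esub> f a) \<oplus>\<^bsub>?Q\<^esub> (B +>\<^bsub>M\<^esub> f b)"
      by (simp add: quot_module_def set_add_def')
  next
    fix r a assume ra: "r \<in> carrier R" "a \<in> carrier L"
    \<comment> \<open>The union in the scalar multiplication of \<open>quot_module\<close> collapses
      to a single coset: representatives differ by elements of \<open>B\<close>, and
      \<open>B\<close> is closed under scalars.\<close>
    have "B +>\<^bsub>M\<^esub> (r \<odot>\<^bsub>M\<^esub> x) = B +>\<^bsub>M\<^esub> (r \<odot>\<^bsub>M\<^esub> f a)" if "x \<in> B +>\<^bsub>M\<^esub> f a" for x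
    proof -
      have x: "x \<in> carrier M" using that fc[OF ra(2)] B.a_elemrcos_carrier by blast
      have "x \<ominus>\<^bsub>M\<^esub> f a \<in> B" using that fc[OF ra(2)] x by (simp add: B.a_rcos_module_imp a_minus_def)
      then have "r \<odot>\<^bsub>M\<^esub> (x \<ominus>\<^bsub>M\<^esub> f a) \<in> B" using Be(4) ra by blast
      then have "r \<odot>\<^bsub>M\<^esub> x \<ominus>\<^bsub>M\<^esub> r \<odot>\<^bsub>M\<^esub> f a \<in> B"
        using ra x fc[OF ra(2)] by (simp add: a_minus_def M.smult_r_distr M.smult_r_minus)
      then show ?thesis using ra x fc[OF ra(2)] by (simp add: eq_iff)
    qed
    moreover have "f a \<in> B +>\<^bsub>M\<^esub> f a" using B.a_rcos_self[OF fc[OF ra(2)]] .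
    ultimately have "(\<Union>x\<in>B +>\<^bsub>M\<^esub> f a. B +>\<^bsub>M\<^esub> (r \<odot>\<^bsub>M\<^esub> x)) = B +>\<^bsub>M\<^esub> (r \<odot>\<^bsub>M\<^esub> f a)"
      by blast
    then show "B +>\<^bsub>M\<^esub> f (r \<odot>\<^bsub>L\<^esub> a) = r \<odot>\<^bsub>?Q\<^esub> (B +>\<^bsub>M\<^esub> f a)"
      using ra by (simp add: quot_module_def coset mod_hom_smult[OF f])
  qed
  have inj: "inj_on ?q (carrier L) \<longleftrightarrow> (\<forall>a\<in>carrier L. f a \<in> B \<longrightarrow> a = \<zero>\<^bsub>L\<^esub>)"
  proof (intro iffI ballI impI)
    fix a assume i: "inj_on ?q (carrier L)" and a: "a \<in> carrier L" "f a \<in> B"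
    have "?q a = ?q \<zero>\<^bsub>L\<^esub>"
      using a fc by (simp add: eq_iff mod_hom_zero[OF L M f] a_minus_def)
    then show "a = \<zero>\<^bsub>L\<^esub>" using i a by (simp add: inj_on_def)
  next
    assume z: "\<forall>a\<in>carrier L. f a \<in> B \<longrightarrow> a = \<zero>\<^bsub>L\<^esub>"
    show "inj_on ?q (carrier L)"
    proof (rule inj_onI)
      fix a b assume ab: "a \<in> carrier L" "b \<in> carrier L" "?q a = ?q b"
      then have "f (a \<ominus>\<^bsub>L\<^esub> b) \<in> B" using fc by (simp add: eq_iff mod_hom_minus[OF L M f])
      then have "a \<ominus>\<^bsub>L\<^esub> b = \<zero>\<^bsub>L\<^esub>" using z ab by simp
      then show "a = b" using ab by (simp add: L.minus_eq_zero_iff)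
    qed
  qed
  have mem: "x \<in> B +>\<^bsub>M\<^esub> y \<longleftrightarrow> (\<exists>b\<in>B. x = b \<oplus>\<^bsub>M\<^esub> y)" for x y
    by (auto simp: a_r_coset_def')
  \<comment> \<open>Equality of two cosets amounts to membership of \<open>x\<close> in the coset of
    \<open>f a\<close>, which is the decomposition on the right.\<close>
  have img: "(\<exists>a\<in>carrier L. B +>\<^bsub>M\<^esub> x = ?q a) \<longleftrightarrow> (\<exists>a\<in>carrier L. \<exists>b\<in>B. x = b \<oplus>\<^bsub>M\<^esub> f a)"
    if "x \<in> K" for x
  proof -
    have x: "x \<in> carrier M" using that Ke(1) by auto
    have "B +>\<^bsub>M\<^esub> x = ?q a \<longleftrightarrow> x \<in> B +>\<^bsub>M\<^esub> f a" if "a \<in> carrier L" for a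
      using M.a_repr_independence[OF _ fc[OF that] Bsub, of x] B.a_rcos_self[OF x] by auto
    then show ?thesis by (auto simp: mem)
  qed
  have surj: "?q ` carrier L = carrier ?Q \<longleftrightarrow> (\<forall>x\<in>K. \<exists>a\<in>carrier L. \<exists>b\<in>B. x = b \<oplus>\<^bsub>M\<^esub> f a)"
  proof -
    have "?q ` carrier L \<subseteq> (\<lambda>x. B +>\<^bsub>M\<^esub> x) ` K" using fK by auto
    then have "?q ` carrier L = carrier ?Q \<longleftrightarrow> (\<forall>x\<in>K. B +>\<^bsub>M\<^esub> x \<in> ?q ` carrier L)"
      unfolding carr by blast
    then show ?thesis using img by (simp add: image_iff)
  qed
  show ?thesis
    unfolding mod_iso_def using hom inj surj by (auto simp: bij_betw_def)
qed

section \<open>Contractible complexes and the cone\<close>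

lemma dsum_module_simps:
  "carrier (dsum_module M N) = carrier M \<times> carrier N"
  "\<zero>\<^bsub>dsum_module M N\<^esub> = (\<zero>\<^bsub>M\<^esub>, \<zero>\<^bsub>N\<^esub>)"
  "(a, x) \<oplus>\<^bsub>dsum_module M N\<^esub> (b, y) = (a \<oplus>\<^bsub>M\<^esub> b, x \<oplus>\<^bsub>N\<^esub> y)"
  "r \<odot>\<^bsub>dsum_module M N\<^esub> (a, x) = (r \<odot>\<^bsub>M\<^esub> a, r \<odot>\<^bsub>N\<^esub> x)"
  by (simp_all add: dsum_module_def)

lemma module_dsum:
  assumes "module R M" "module R N"
  shows "module R (dsum_module M N)"
proof -
  interpret M: module R M by fact
  interpret N: module R N by fact
  have "abelian_group (dsum_module M N)"
  proof (rule abelian_groupI)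
    fix z assume "z \<in> carrier (dsum_module M N)"
    then obtain a x where z: "z = (a, x)" "a \<in> carrier M" "x \<in> carrier N"
      by (auto simp: dsum_module_simps)
    then have "(\<ominus>\<^bsub>M\<^esub> a, \<ominus>\<^bsub>N\<^esub> x) \<oplus>\<^bsub>dsum_module M N\<^esub> z = \<zero>\<^bsub>dsum_module M N\<^esub>"
      by (simp add: dsum_module_simps M.l_neg N.l_neg)
    then show "\<exists>y\<in>carrier (dsum_module M N). y \<oplus>\<^bsub>dsum_module M N\<^esub> z = \<zero>\<^bsub>dsum_module M N\<^esub>"
      using z by (intro bexI[of _ "(\<ominus>\<^bsub>M\<^esub> a, \<ominus>\<^bsub>N\<^esub> x)"]) (auto simp: dsum_module_simps)
  qed (auto simp: dsum_module_simps M.a_ac N.a_ac)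
  then show ?thesis
    by (intro moduleI M.is_cring)
      (auto simp: dsum_module_simps M.smult_l_distr N.smult_l_distr M.smult_r_distr
        N.smult_r_distr M.smult_assoc1 N.smult_assoc1)
qed

lemma zero_cx_simps:
  "carrier (obj zero_cx n) = {()}"
  by (simp add: zero_cx_def)

text \<open>A homotopy from \<open>0\<close> to the identity is the negative of a contraction \<open>H\<close>.\<close>

lemma homotopy_equiv_zero_iff:
  assumes X: "\<And>n. module R (obj X n)"
    and d: "\<And>n. dif X n \<in> mod_hom R (obj X n) (obj X (n + 1))"
  shows "homotopy_equiv R X zero_cx \<longleftrightarrow>
    (\<exists>H. (\<forall>i. H i \<in> mod_hom R (obj X i) (obj X (i - 1))) \<and>
         (\<forall>i. \<forall>x\<in>carrier (obj X i).
            dif X (i - 1) (H i x) \<oplus>\<^bsub>obj X i\<^esub> H (i + 1) (dif X i x) = x))"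
    (is "_ \<longleftrightarrow> (\<exists>H. ?contraction H)")
proof
  have d': "dif X (i - 1) \<in> mod_hom R (obj X (i - 1)) (obj X i)" for i
    using d[of "i - 1"] by simp
  \<comment> \<open>The sign passes through the differential and the sum, so homotopies from
    \<open>0\<close> to the identity and contractions are exchanged by negation; both directions use
    this.\<close>
  have neg: "dif X (i - 1) (\<ominus>\<^bsub>obj X (i - 1)\<^esub> H i x) \<oplus>\<^bsub>obj X i\<^esub> \<ominus>\<^bsub>obj X i\<^esub> H (i + 1) (dif X i x) =
      \<ominus>\<^bsub>obj X i\<^esub> (dif X (i - 1) (H i x) \<oplus>\<^bsub>obj X i\<^esub> H (i + 1) (dif X i x))"
    if "\<forall>i. H i \<in> mod_hom R (obj X i) (obj X (i - 1))" "x \<in> carrier (obj X i)" for H i x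
  proof -
    interpret Xi: module R "obj X i" by (rule X)
    have H: "H i \<in> mod_hom R (obj X i) (obj X (i - 1))" "H (i + 1) \<in> mod_hom R (obj X (i + 1)) (obj X i)"
      using that(1)[rule_format, of i] that(1)[rule_format, of "i + 1"] by simp_all
    note c = mod_hom_closed[OF H(1) that(2)] mod_hom_closed[OF d that(2)]
    have "dif X (i - 1) (H i x) \<in> carrier (obj X i)" "H (i + 1) (dif X i x) \<in> carrier (obj X i)"
      using mod_hom_closed[OF d' c(1)] mod_hom_closed[OF H(2) c(2)] by simp_all
    then show "dif X (i - 1) (\<ominus>\<^bsub>obj X (i - 1)\<^esub> H i x) \<oplus>\<^bsub>obj X i\<^esub> \<ominus>\<^bsub>obj X i\<^esub> H (i + 1) (dif X i x) =
      \<ominus>\<^bsub>obj X i\<^esub> (dif X (i - 1) (H i x) \<oplus>\<^bsub>obj X i\<^esub> H (i + 1) (dif X i x))"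
      by (simp add: mod_hom_a_inv[OF X X d' c(1)] Xi.minus_add)
  qed
  {
    assume "homotopy_equiv R X zero_cx"
    then obtain f g \<Psi> where g: "chain_map R zero_cx X g"
      and \<Psi>: "\<forall>i. \<Psi> i \<in> mod_hom R (obj X i) (obj X (i - 1))"
      and eq: "\<And>i x. x \<in> carrier (obj X i) \<Longrightarrow> g i (f i x :: unit) \<ominus>\<^bsub>obj X i\<^esub> x =
             dif X (i - 1) (\<Psi> i x) \<oplus>\<^bsub>obj X i\<^esub> \<Psi> (i + 1) (dif X i x)"
      by (auto simp: homotopy_equiv_def homotopic_def)
    define H where "H i x = \<ominus>\<^bsub>obj X (i - 1)\<^esub> \<Psi> i x" for i x
    have "H i \<in> mod_hom R (obj X i) (obj X (i - 1))" for i
      unfolding H_def using \<Psi> by (intro mod_hom_neg X) auto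
    moreover have "dif X (i - 1) (H i x) \<oplus>\<^bsub>obj X i\<^esub> H (i + 1) (dif X i x) = x"
      if x: "x \<in> carrier (obj X i)" for i x
    proof -
      interpret Xi: module R "obj X i" by (rule X)
      have gi: "g i \<in> mod_hom R (obj zero_cx i) (obj X i)" using g by (simp add: chain_map_def)
      have gc: "g i () \<in> carrier (obj X i)" using mod_hom_closed[OF gi] by (simp add: zero_cx_simps)
      \<comment> \<open>In the zero module \<open>()\<close> is its own double, so
        \<open>g i ()\<close> is additively idempotent and therefore zero. Hence the composite of
        \<open>f\<close> and \<open>g\<close> on \<open>X\<close> vanishes.\<close>
      have "g i () \<oplus>\<^bsub>obj X i\<^esub> g i () = g i ()"
        using mod_hom_add[OF gi, of "()" "()"] by (simp add: zero_cx_simps)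
      then have "g i () = \<zero>\<^bsub>obj X i\<^esub>" using gc by simp
      then have "\<ominus>\<^bsub>obj X i\<^esub> (\<ominus>\<^bsub>obj X i\<^esub> x) =
          \<ominus>\<^bsub>obj X i\<^esub> (dif X (i - 1) (\<Psi> i x) \<oplus>\<^bsub>obj X i\<^esub> \<Psi> (i + 1) (dif X i x))"
        using eq[OF x] x by (simp add: a_minus_def)
      then show ?thesis using neg[OF \<Psi> x] x by (simp add: H_def)
    qed
    ultimately show "\<exists>H. ?contraction H" by blast
  }
  assume "\<exists>H. ?contraction H"
  then obtain H where H: "\<forall>i. H i \<in> mod_hom R (obj X i) (obj X (i - 1))"
    and eq: "\<And>i x. x \<in> carrier (obj X i) \<Longrightarrow>
      dif X (i - 1) (H i x) \<oplus>\<^bsub>obj X i\<^esub> H (i + 1) (dif X i x) = x"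
    by blast
  have z: "(\<lambda>_. \<zero>\<^bsub>obj X i\<^esub>) \<in> mod_hom R (obj zero_cx i) (obj X i)" for i
  proof -
    interpret Xi: module R "obj X i" by (rule X)
    show ?thesis by (rule mod_homI) auto
  qed
  have "homotopic R X X (\<lambda>n. (\<lambda>_. \<zero>\<^bsub>obj X n\<^esub>) \<circ> (\<lambda>_. ())) (\<lambda>n. id)"
    unfolding homotopic_def
  proof (intro exI[of _ "\<lambda>i x. \<ominus>\<^bsub>obj X (i - 1)\<^esub> H i x"] conjI allI ballI)
    fix i show "(\<lambda>x. \<ominus>\<^bsub>obj X (i - 1)\<^esub> H i x) \<in> mod_hom R (obj X i) (obj X (i - 1))"
      using H by (intro mod_hom_neg X) auto
  next
    fix i x assume x: "x \<in> carrier (obj X i)"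
    interpret Xi: module R "obj X i" by (rule X)
    show "((\<lambda>_. \<zero>\<^bsub>obj X i\<^esub>) \<circ> (\<lambda>_. ())) x \<ominus>\<^bsub>obj X i\<^esub> id x =
       dif X (i - 1) (\<ominus>\<^bsub>obj X (i - 1)\<^esub> H i x) \<oplus>\<^bsub>obj X i\<^esub> \<ominus>\<^bsub>obj X (i + 1 - 1)\<^esub> H (i + 1) (dif X i x)"
      using neg[OF H x] eq[OF x] x by (simp add: a_minus_def)
  qed
  moreover have "chain_map R zero_cx X (\<lambda>n _. \<zero>\<^bsub>obj X n\<^esub>)"
    using z mod_hom_zero[OF X X d] by (simp add: chain_map_def)
  moreover have "chain_map R X zero_cx (\<lambda>n _. ())"
    by (simp add: chain_map_def mod_hom_def zero_cx_simps)
  moreover have "homotopic R zero_cx zero_cx (\<lambda>n. (\<lambda>_. ()) \<circ> (\<lambda>_. \<zero>\<^bsub>obj X n\<^esub>)) (\<lambda>n. id)"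
    by (auto simp: homotopic_def mod_hom_def zero_cx_simps)
  ultimately show "homotopy_equiv R X zero_cx"
    unfolding homotopy_equiv_def by blast
qed

text \<open>The facts about \<open>n - 1\<close> are stated with target degree \<open>n\<close>
  already normalised: boundaries in degree \<open>n\<close> come from there, and plain instantiation
  would leave indices such as \<open>n - 1 + 1\<close>.\<close>

lemma fg_free_cxD:
  assumes "fg_free_cx R X"
  shows "fg_free R (obj X n)" "module R (obj X n)"
    "dif X n \<in> mod_hom R (obj X n) (obj X (n + 1))"
    "dif X (n - 1) \<in> mod_hom R (obj X (n - 1)) (obj X n)"
    "x \<in> carrier (obj X (n - 1)) \<Longrightarrow> dif X n (dif X (n - 1) x) = \<zero>\<^bsub>obj X (n + 1)\<^esub>"
proof -
  have *: "\<And>n. dif X n \<in> mod_hom R (obj X n) (obj X (n + 1))"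
    "\<And>n x. x \<in> carrier (obj X n) \<Longrightarrow> dif X (n + 1) (dif X n x) = \<zero>\<^bsub>obj X (n + 2)\<^esub>"
    using assms by (auto simp: fg_free_cx_def)
  show "fg_free R (obj X n)" "module R (obj X n)"
    using assms by (auto simp: fg_free_cx_def fg_free_def)
  show "dif X n \<in> mod_hom R (obj X n) (obj X (n + 1))"
    by (rule *)
  show "dif X (n - 1) \<in> mod_hom R (obj X (n - 1)) (obj X n)"
    using *(1)[of "n - 1"] by simp
  show "dif X n (dif X (n - 1) x) = \<zero>\<^bsub>obj X (n + 1)\<^esub>" if "x \<in> carrier (obj X (n - 1))"
    using *(2)[OF that] by (simp add: algebra_simps)
qed

section \<open>Cohomology and contractibility of the cone\<close>

theorem theorem3p3:
  fixes R :: "('r, 'm) ring_scheme"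
    and L :: "('r, 'a) cx"
    and F :: "('r, 'b) cx"
    and G :: "int \<Rightarrow> 'b set"
    and \<alpha> :: "int \<Rightarrow> 'a \<Rightarrow> 'b"
  assumes "cring R"
    and "fg_free_cx R F"
    and "fg_free_cx R L"
    and "\<And>n x. x \<in> carrier (obj L n) \<Longrightarrow> dif L n x = \<zero>\<^bsub>obj L (n + 1)\<^esub>"
    and "\<And>n. submodule (G n) R (obj F n)"
    and "\<And>n. is_direct_sum R (obj F n) (G n) (boundaries F n)"
    and "chain_map R L F \<alpha>"
    and "\<And>n. \<alpha> n ` carrier (obj L n) \<subseteq> G n"
  shows "(\<forall>n. class_map F \<alpha> n \<in> mod_iso R (obj L n) (cohomology F n) \<and>
              inj_on (\<alpha> n) (carrier (obj L n)) \<and> \<alpha> n ` carrier (obj L n) \<subseteq> G n)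
         \<longleftrightarrow> homotopy_equiv R (cone L F \<alpha>) zero_cx"
proof -
  let ?Z = "cone L F \<alpha>"
  note F = fg_free_cxD[OF assms(2)] and L = fg_free_cxD[OF assms(3)]

  \<comment> \<open>Cycles, boundaries and the isomorphism onto cohomology\<close>
  have \<alpha>: "\<alpha> n \<in> mod_hom R (obj L n) (obj F n)" for n
    using assms(7) by (simp add: chain_map_def)
  \<comment> \<open>The zero differential of \<open>L\<close> forces \<alpha> to take values in
    cycles, which is why it induces a map to cohomology.\<close>
  have d\<alpha>: "dif F n (\<alpha> n a) = \<zero>\<^bsub>obj F (n + 1)\<^esub>" if "a \<in> carrier (obj L n)" for n a
  proof -
    have "dif F n (\<alpha> n a) = \<alpha> (n + 1) (dif L n a)"
      using assms(7) that by (simp add: chain_map_def)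
    then show ?thesis by (simp add: assms(4)[OF that] mod_hom_zero[OF L(2) F(2) \<alpha>])
  qed
  have B: "submodule (boundaries F n) R (obj F n)" for n
    using assms(6)[of n] by (simp add: is_direct_sum_def)
  have in_B: "x \<in> boundaries F n \<longleftrightarrow> (\<exists>y\<in>carrier (obj F (n - 1)). x = dif F (n - 1) y)" for x n
    by (auto simp: boundaries_def)
  have cycle_iff: "x \<in> a_kernel (obj F n) (obj F (n + 1)) (dif F n) \<longleftrightarrow>
      x \<in> carrier (obj F n) \<and> dif F n x = \<zero>\<^bsub>obj F (n + 1)\<^esub>" for x n
    by (simp add: a_kernel_def')
  have iso_iff: "class_map F \<alpha> n \<in> mod_iso R (obj L n) (cohomology F n) \<longleftrightarrow>
      (\<forall>a\<in>carrier (obj L n). \<alpha> n a \<in> boundaries F n \<longrightarrow> a = \<zero>\<^bsub>obj L n\<^esub>) \<and>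
      (\<forall>x\<in>a_kernel (obj F n) (obj F (n + 1)) (dif F n).
        \<exists>a\<in>carrier (obj L n). \<exists>b\<in>boundaries F n. x = b \<oplus>\<^bsub>obj F n\<^esub> \<alpha> n a)" for n
  proof -
    have "boundaries F n \<subseteq> a_kernel (obj F n) (obj F (n + 1)) (dif F n)"
      using mod_hom_closed[OF F(4)] F(5) by (auto simp: in_B cycle_iff)
    moreover have "\<alpha> n ` carrier (obj L n) \<subseteq> a_kernel (obj F n) (obj F (n + 1)) (dif F n)"
      using mod_hom_closed[OF \<alpha>] d\<alpha> by (auto simp: cycle_iff)
    ultimately show ?thesis
      using quotient_map_mod_iso_iff[OF L(2) F(2) mod_hom_kernel_submodule[OF F(2) F(2) F(3)] B _ \<alpha>]
      by (simp add: class_map_def[abs_def] cohomology_def)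
  qed

  \<comment> \<open>Degreewise structure of the cone\<close>
  have Z_obj: "obj ?Z n = dsum_module (obj L (n + 1)) (obj F n)" for n
    by (simp add: cone_def)
  have Z_dif: "dif ?Z n (a, x) = (\<zero>\<^bsub>obj L (n + 2)\<^esub>, \<alpha> (n + 1) a \<oplus>\<^bsub>obj F (n + 1)\<^esub> dif F n x)" for n a x
    by (simp add: cone_def)
  have Z_dif': "dif ?Z (n - 1) (a, x) = (\<zero>\<^bsub>obj L (n + 1)\<^esub>, \<alpha> n a \<oplus>\<^bsub>obj F n\<^esub> dif F (n - 1) x)" for n a x
    by (simp add: Z_dif add.commute)
  have Z_mod: "module R (obj ?Z n)" for n
    unfolding Z_obj by (intro module_dsum L F)
  have Z_hom: "dif ?Z n \<in> mod_hom R (obj ?Z n) (obj ?Z (n + 1))" for n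
  proof -
    interpret L': module R "obj L (n + 2)" by (rule L)
    interpret F': module R "obj F (n + 1)" by (rule F)
    \<comment> \<open>The cone in degree \<open>n + 1\<close> has first summand
      \<open>obj L (n + 1 + 1)\<close>, whereas its differential writes the zero of
      \<open>obj L (n + 2)\<close>.\<close>
    have eq: "n + 1 + 1 = n + 2" by simp
    note c = mod_hom_closed[OF \<alpha>] mod_hom_closed[OF F(3)]
    show ?thesis
      by (rule mod_homI)
        (auto simp: Z_obj Z_dif dsum_module_simps eq c mod_hom_add[OF \<alpha>] mod_hom_add[OF F(3)]
          mod_hom_smult[OF \<alpha>] mod_hom_smult[OF F(3)] F'.a_ac F'.smult_r_distr)
  qed
  note contractible_iff = homotopy_equiv_zero_iff[OF Z_mod Z_hom]
  show ?thesis
  proof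

    \<comment> \<open>From a contraction of the cone to cohomology\<close>
    assume "homotopy_equiv R ?Z zero_cx"
    then obtain H where H: "\<And>i. H i \<in> mod_hom R (obj ?Z i) (obj ?Z (i - 1))"
      and contr: "\<And>i z. z \<in> carrier (obj ?Z i) \<Longrightarrow>
        dif ?Z (i - 1) (H i z) \<oplus>\<^bsub>obj ?Z i\<^esub> H (i + 1) (dif ?Z i z) = z"
      unfolding contractible_iff by blast
    \<comment> \<open>For a cycle \<open>z\<close> of the cone, \<open>H\<close> sends its
      differential to zero, so the contraction identity leaves \<open>z\<close> as the differential
      of \<open>H n z\<close>. The pair \<open>(b, y)\<close> consists of the components of
      \<open>H n z\<close>, and \<open>b\<close> lies in degree \<open>n\<close> of \<open>L\<close>
      because of the shift.\<close>
    have exact: "\<exists>b\<in>carrier (obj L n). \<exists>y\<in>carrier (obj F (n - 1)).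
        (a, x) = (\<zero>\<^bsub>obj L (n + 1)\<^esub>, \<alpha> n b \<oplus>\<^bsub>obj F n\<^esub> dif F (n - 1) y)"
      if ax: "a \<in> carrier (obj L (n + 1))" "x \<in> carrier (obj F n)"
        and 0: "\<alpha> (n + 1) a \<oplus>\<^bsub>obj F (n + 1)\<^esub> dif F n x = \<zero>\<^bsub>obj F (n + 1)\<^esub>" for n a x
    proof -
      interpret Z: module R "obj ?Z n" by (rule Z_mod)
      have z: "(a, x) \<in> carrier (obj ?Z n)" using ax by (simp add: Z_obj dsum_module_simps)
      have "dif ?Z n (a, x) = \<zero>\<^bsub>obj ?Z (n + 1)\<^esub>"
        using 0 by (simp add: Z_dif Z_obj dsum_module_simps add.assoc)
      then have "H (n + 1) (dif ?Z n (a, x)) = \<zero>\<^bsub>obj ?Z n\<^esub>"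
        using mod_hom_zero[OF Z_mod Z_mod H, of "n + 1"] by simp
      moreover have Hc: "H n (a, x) \<in> carrier (obj ?Z (n - 1))"
        by (rule mod_hom_closed[OF H z])
      moreover have "dif ?Z (n - 1) (H n (a, x)) \<in> carrier (obj ?Z n)"
        using mod_hom_closed[OF Z_hom Hc] by simp
      ultimately have "(a, x) = dif ?Z (n - 1) (H n (a, x))"
        using contr[OF z] by simp
      moreover obtain b y where "H n (a, x) = (b, y)" by fastforce
      ultimately show ?thesis using Hc by (auto simp: Z_obj dsum_module_simps Z_dif')
    qed
    have zero: "a = \<zero>\<^bsub>obj L n\<^esub>" if a: "a \<in> carrier (obj L n)" "\<alpha> n a \<in> boundaries F n" for n a
    proof -
      interpret F1: module R "obj F (n - 1)" by (rule F)
      interpret Fn: module R "obj F n" by (rule F)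
      obtain y where y: "y \<in> carrier (obj F (n - 1))" "\<alpha> n a = dif F (n - 1) y"
        using a(2) by (auto simp: in_B)
      have "\<alpha> n a \<oplus>\<^bsub>obj F n\<^esub> dif F (n - 1) (\<ominus>\<^bsub>obj F (n - 1)\<^esub> y) = \<zero>\<^bsub>obj F n\<^esub>"
        using y mod_hom_closed[OF F(4)] by (simp add: mod_hom_a_inv[OF F(2) F(2) F(4)] Fn.r_neg)
      \<comment> \<open>An element of \<open>obj L n\<close> sits in degree \<open>n - 1\<close> of
        the cone. The pair \<open>(a, -y)\<close> is a cycle there, hence a boundary, and boundaries
        of the cone have first component zero.\<close>
      then show ?thesis using exact[of a "n - 1" "\<ominus>\<^bsub>obj F (n - 1)\<^esub> y"] a y(1) by auto
    qed
    have "\<exists>a\<in>carrier (obj L n). \<exists>b\<in>boundaries F n. x = b \<oplus>\<^bsub>obj F n\<^esub> \<alpha> n a"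
      if x: "x \<in> carrier (obj F n)" "dif F n x = \<zero>\<^bsub>obj F (n + 1)\<^esub>" for n x
    proof -
      interpret Fn: module R "obj F n" by (rule F)
      interpret F1: module R "obj F (n + 1)" by (rule F)
      interpret L1: module R "obj L (n + 1)" by (rule L)
      \<comment> \<open>Exactness is applied to \<open>(0, x)\<close>; its second component gives
        the required decomposition up to the order of summands.\<close>
      obtain b y where "b \<in> carrier (obj L n)" "y \<in> carrier (obj F (n - 1))"
        "x = \<alpha> n b \<oplus>\<^bsub>obj F n\<^esub> dif F (n - 1) y"
        using exact[of "\<zero>\<^bsub>obj L (n + 1)\<^esub>" n x] x by (auto simp: mod_hom_zero[OF L(2) F(2) \<alpha>])
      then show ?thesis
        using mod_hom_closed[OF \<alpha>] mod_hom_closed[OF F(4)] by (auto simp: in_B Fn.a_comm intro!: bexI)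
    qed
    then have "class_map F \<alpha> n \<in> mod_iso R (obj L n) (cohomology F n)" for n
      using zero by (simp add: iso_iff cycle_iff)
    moreover have "inj_on (\<alpha> n) (carrier (obj L n))" for n
    proof (rule inj_onI)
      interpret Ln: module R "obj L n" by (rule L)
      interpret Fn: module R "obj F n" by (rule F)
      fix a b assume ab: "a \<in> carrier (obj L n)" "b \<in> carrier (obj L n)" "\<alpha> n a = \<alpha> n b"
      then have "\<alpha> n (a \<ominus>\<^bsub>obj L n\<^esub> b) = \<zero>\<^bsub>obj F n\<^esub>"
        using mod_hom_closed[OF \<alpha>] by (simp add: mod_hom_minus[OF L(2) F(2) \<alpha>] Fn.minus_eq_zero_iff)
      \<comment> \<open>Since zero is a boundary, the vanishing statement \<open>zero\<close>
        applies to \<open>a - b\<close>, so injectivity on classes yields injectivity of \<alpha>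
        itself.\<close>
      moreover have "\<zero>\<^bsub>obj F n\<^esub> \<in> boundaries F n"
        using subgroup.one_closed[OF submodule.axioms(1)[OF B]] by simp
      ultimately have "a \<ominus>\<^bsub>obj L n\<^esub> b = \<zero>\<^bsub>obj L n\<^esub>" using zero ab by simp
      then show "a = b" using ab by (simp add: Ln.minus_eq_zero_iff)
    qed
    ultimately show "\<forall>n. class_map F \<alpha> n \<in> mod_iso R (obj L n) (cohomology F n) \<and>
        inj_on (\<alpha> n) (carrier (obj L n)) \<and> \<alpha> n ` carrier (obj L n) \<subseteq> G n"
      using assms(8) by blast
  next

    \<comment> \<open>Lifting maps and constructing a contraction of the cone\<close>
    assume "\<forall>n. class_map F \<alpha> n \<in> mod_iso R (obj L n) (cohomology F n) \<and>
        inj_on (\<alpha> n) (carrier (obj L n)) \<and> \<alpha> n ` carrier (obj L n) \<subseteq> G n"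
    then have zero: "\<And>n a. a \<in> carrier (obj L n) \<Longrightarrow> \<alpha> n a \<in> boundaries F n \<Longrightarrow> a = \<zero>\<^bsub>obj L n\<^esub>"
      and inj: "\<And>n. inj_on (\<alpha> n) (carrier (obj L n))"
      and class_surj: "\<And>n x. x \<in> carrier (obj F n) \<Longrightarrow> dif F n x = \<zero>\<^bsub>obj F (n + 1)\<^esub> \<Longrightarrow>
        \<exists>a\<in>carrier (obj L n). \<exists>b\<in>boundaries F n. x = b \<oplus>\<^bsub>obj F n\<^esub> \<alpha> n a"
      by (simp_all add: iso_iff cycle_iff)
    have GF: "G n \<subseteq> carrier (obj F n)" for n
      using module.submoduleE(1)[OF F(2) assms(5)] .
    have B_int_G: "x = \<zero>\<^bsub>obj F n\<^esub>" if "x \<in> G n" "x \<in> boundaries F n" for x n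
      using assms(6)[of n] that by (auto simp: is_direct_sum_def)
    have dB: "dif F n x = \<zero>\<^bsub>obj F (n + 1)\<^esub>" if "x \<in> boundaries F n" for n x
      using that F(5) by (auto simp: in_B)
    \<comment> \<open>The boundary \<open>b\<close> in the decomposition of \<open>x\<close> equals
      \<open>x - \<alpha> n a\<close>, a difference of elements of \<open>G n\<close>, and
      \<open>G n\<close> meets the boundaries only in zero.\<close>
    have cycle_G: "\<exists>a\<in>carrier (obj L n). x = \<alpha> n a" if x: "x \<in> G n" "dif F n x = \<zero>\<^bsub>obj F (n + 1)\<^esub>" for n x
    proof -
      interpret Fn: module R "obj F n" by (rule F)
      obtain a b where ab: "a \<in> carrier (obj L n)" "b \<in> boundaries F n" "x = b \<oplus>\<^bsub>obj F n\<^esub> \<alpha> n a"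
        using class_surj[of x n] x GF by blast
      have c: "b \<in> carrier (obj F n)" "\<alpha> n a \<in> carrier (obj F n)" "\<alpha> n a \<in> G n"
        using module.submoduleE(1)[OF F(2) B] ab mod_hom_closed[OF \<alpha>] assms(8)[of n] by auto
      have "b = x \<ominus>\<^bsub>obj F n\<^esub> \<alpha> n a" using ab c by (simp add: a_minus_def Fn.a_assoc Fn.r_neg)
      also have "\<dots> \<in> G n" using x c Fn.submoduleE(3,5)[OF assms(5)] by (simp add: a_minus_def)
      finally have "b = \<zero>\<^bsub>obj F n\<^esub>" using ab(2) B_int_G by blast
      then show ?thesis using ab c by auto
    qed
    have "\<forall>n. \<exists>p. p \<in> mod_hom R (obj F n) (obj F n) \<and>
        (\<forall>x\<in>carrier (obj F n). p x \<in> boundaries F n) \<and>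
        (\<forall>x\<in>carrier (obj F n). x \<ominus>\<^bsub>obj F n\<^esub> p x \<in> G n) \<and>
        (\<forall>x\<in>G n. p x = \<zero>\<^bsub>obj F n\<^esub>) \<and> (\<forall>x\<in>boundaries F n. p x = x)"
      by (rule allI, rule direct_sum_projection[OF F(2) assms(6)]) blast
    from choice[OF this] obtain p where p: "\<And>n. p n \<in> mod_hom R (obj F n) (obj F n)"
      and pB: "\<And>n x. x \<in> carrier (obj F n) \<Longrightarrow> p n x \<in> boundaries F n"
      and pG: "\<And>n x. x \<in> carrier (obj F n) \<Longrightarrow> x \<ominus>\<^bsub>obj F n\<^esub> p n x \<in> G n"
      and p0: "\<And>n x. x \<in> G n \<Longrightarrow> p n x = \<zero>\<^bsub>obj F n\<^esub>"
      and pid: "\<And>n x. x \<in> boundaries F n \<Longrightarrow> p n x = x"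
      by blast
    have pc: "p n x \<in> carrier (obj F n)" if "x \<in> carrier (obj F n)" for n x
      by (rule mod_hom_closed[OF p that])
    \<comment> \<open>Lifting into the module \<open>?G (n - 1)\<close>, not into all of
      \<open>F\<close>, builds the containment of the values in \<open>G (n - 1)\<close> into the
      lift.\<close>
    let ?G = "\<lambda>n. obj F n\<lparr>carrier := G n\<rparr>"
    have Gmod: "module R (?G n)" for n
      by (rule submodule.submodule_is_module[OF assms(5) F(2)])
    have "\<forall>n. \<exists>t. t \<in> mod_hom R (obj F n) (?G (n - 1)) \<and>
        (\<forall>x\<in>carrier (obj F n). dif F (n - 1) (t x) = p n x)"
    proof
      fix n
      interpret Fn: module R "obj F n" by (rule F)
      have dG: "dif F (n - 1) \<in> mod_hom R (?G (n - 1)) (obj F n)"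
        using F(4)[of n] GF[of "n - 1"] by (auto simp: mod_hom_def Pi_iff subset_iff)
      \<comment> \<open>A preimage \<open>y\<close> of \<open>p n x\<close> is corrected to
        \<open>y - p (n - 1) y\<close>, which lies in \<open>G (n - 1)\<close>; the differential is
        unaffected because the subtracted term is a boundary.\<close>
      have "p n x \<in> dif F (n - 1) ` carrier (?G (n - 1))" if x: "x \<in> carrier (obj F n)" for x
      proof -
        obtain y where y: "y \<in> carrier (obj F (n - 1))" "p n x = dif F (n - 1) y"
          using pB[OF x] by (auto simp: in_B)
        have "dif F (n - 1) (p (n - 1) y) = \<zero>\<^bsub>obj F n\<^esub>" using dB[OF pB[OF y(1)]] by simp
        then have "dif F (n - 1) (y \<ominus>\<^bsub>obj F (n - 1)\<^esub> p (n - 1) y) = p n x"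
          using y pc[OF y(1)] mod_hom_closed[OF F(4) y(1)]
          by (simp add: mod_hom_minus[OF F(2) F(2) F(4)] Fn.a_minus_zero)
        then show ?thesis using pG[OF y(1)] by (auto intro!: image_eqI)
      qed
      then obtain t where "t \<in> mod_hom R (obj F n) (?G (n - 1))"
        "\<And>x. x \<in> carrier (obj F n) \<Longrightarrow> dif F (n - 1) (t x) = p n x"
        using fg_free_lift[OF F(1) F(2) Gmod p dG] by blast
      then show "\<exists>t. t \<in> mod_hom R (obj F n) (?G (n - 1)) \<and>
          (\<forall>x\<in>carrier (obj F n). dif F (n - 1) (t x) = p n x)"
        by blast
    qed
    from choice[OF this] obtain t where t: "\<And>n. t n \<in> mod_hom R (obj F n) (?G (n - 1))"
      and dt: "\<And>n x. x \<in> carrier (obj F n) \<Longrightarrow> dif F (n - 1) (t n x) = p n x"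
      by blast
    \<comment> \<open>Precomposing the lift with \<open>p\<close> makes it vanish on \<open>G\<close>.\<close>
    define s where "s n x = t n (p n x)" for n x
    have sG: "s n x \<in> G (n - 1)" if "x \<in> carrier (obj F n)" for n x
      using mod_hom_closed[OF t pc[OF that]] by (simp add: s_def)
    have s: "s n \<in> mod_hom R (obj F n) (obj F (n - 1))" for n
      using mod_hom_compose[OF p t[of n]] GF[of "n - 1"] unfolding s_def
      by (auto simp: mod_hom_def Pi_iff subset_iff)
    have s': "s (n + 1) \<in> mod_hom R (obj F (n + 1)) (obj F n)" for n
      using s[of "n + 1"] by simp
    \<comment> \<open>Precomposition with \<open>p\<close> does not spoil the lifting property, as
      \<open>p\<close> fixes boundaries and is thus idempotent.\<close>
    have ds: "dif F (n - 1) (s n x) = p n x" if "x \<in> carrier (obj F n)" for n x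
      using dt[OF pc[OF that]] pid[OF pB[OF that]] by (simp add: s_def)
    have s0: "s n x = \<zero>\<^bsub>obj F (n - 1)\<^esub>" if "x \<in> G n" for n x
      using mod_hom_zero[OF F(2) Gmod t] p0[OF that] by (simp add: s_def)
    \<comment> \<open>With \<open>d s = p\<close>, this is the identity minus
      \<open>d s + s d\<close>: it measures how far \<open>s\<close> is from contracting
      \<open>F\<close>, and is the part that \<alpha> has to account for.\<close>
    define w where "w n x = (x \<ominus>\<^bsub>obj F n\<^esub> p n x) \<ominus>\<^bsub>obj F n\<^esub> s (n + 1) (dif F n x)" for n x
    have w: "w n \<in> mod_hom R (obj F n) (obj F n)" for n
      unfolding w_def
      by (intro mod_hom_diff[OF F(2) F(2)] mod_hom_id p mod_hom_compose[OF F(3) s'])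
    \<comment> \<open>Both \<open>x - p x\<close> and \<open>s (d x)\<close> lie in
      \<open>G n\<close>, hence so does \<open>w n x\<close>. It is a cycle because
      \<open>d (p x) = 0\<close> and \<open>d (s (d x)) = p (d x) = d x\<close>; then
      \<open>cycle_G\<close> applies.\<close>
    have w_im: "w n ` carrier (obj F n) \<subseteq> \<alpha> n ` carrier (obj L n)" for n
    proof
      fix u assume "u \<in> w n ` carrier (obj F n)"
      then obtain x where x: "x \<in> carrier (obj F n)" "u = w n x" by blast
      interpret Fn: module R "obj F n" by (rule F)
      interpret F1: module R "obj F (n + 1)" by (rule F)
      note dx = mod_hom_closed[OF F(3) x(1)]
      have sG': "s (n + 1) (dif F n x) \<in> G n" using sG[OF dx] by simp
      then have "w n x \<in> G n"
        using pG[OF x(1)] Fn.submoduleE(3,5)[OF assms(5)] by (simp add: w_def a_minus_def)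
      moreover have "dif F n (w n x) = \<zero>\<^bsub>obj F (n + 1)\<^esub>"
      proof -
        have "dif F n x \<in> boundaries F (n + 1)" using x(1) by (auto simp: in_B)
        then have "dif F n (s (n + 1) (dif F n x)) = dif F n x"
          using ds[OF dx] pid by simp
        moreover have "dif F n (p n x) = \<zero>\<^bsub>obj F (n + 1)\<^esub>" by (rule dB[OF pB[OF x(1)]])
        moreover have "s (n + 1) (dif F n x) \<in> carrier (obj F n)" using sG' GF by blast
        ultimately show ?thesis
          using x(1) dx pc[OF x(1)]
          by (simp add: w_def mod_hom_minus[OF F(2) F(2) F(3)] F1.a_minus_zero F1.minus_eq_zero_iff)
      qed
      ultimately show "u \<in> \<alpha> n ` carrier (obj L n)" using cycle_G x(2) by blast
    qed
    \<comment> \<open>Freeness of \<open>obj F n\<close> gives a linear factorisation of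
      \<open>w\<close> through \<alpha> at once.\<close>
    have "\<forall>n. \<exists>q. q \<in> mod_hom R (obj F n) (obj L n) \<and> (\<forall>x\<in>carrier (obj F n). \<alpha> n (q x) = w n x)"
      by (rule allI, rule fg_free_lift[OF F(1) F(2) L(2) w \<alpha> w_im]) blast
    from choice[OF this] obtain q where q: "\<And>n. q n \<in> mod_hom R (obj F n) (obj L n)"
      and \<alpha>q: "\<And>n x. x \<in> carrier (obj F n) \<Longrightarrow> \<alpha> n (q n x) = w n x"
      by blast
    \<comment> \<open>As \<alpha> is injective, values of \<open>q\<close> can be found by computing
      \<open>w\<close>.\<close>
    have q_eq: "q n x = a" if "x \<in> carrier (obj F n)" "a \<in> carrier (obj L n)" "w n x = \<alpha> n a" for n x a
      using that \<alpha>q mod_hom_closed[OF q] inj by (metis inj_onD)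
    have q_add: "q n (x \<oplus>\<^bsub>obj F n\<^esub> y) = q n x \<oplus>\<^bsub>obj L n\<^esub> q n y"
      if "x \<in> carrier (obj F n)" "y \<in> carrier (obj F n)" for n x y
      by (rule mod_hom_add[OF q that])
    \<comment> \<open>\<open>w\<close> fixes \<open>\<alpha> n a\<close>: the projection kills it
      because it lies in \<open>G n\<close>, and the last term vanishes because it is a
      cycle.\<close>
    have q\<alpha>: "q n (\<alpha> n a) = a" if a: "a \<in> carrier (obj L n)" for n a
    proof (rule q_eq)
      interpret Fn: module R "obj F n" by (rule F)
      have "p n (\<alpha> n a) = \<zero>\<^bsub>obj F n\<^esub>" using p0 assms(8) a by blast
      moreover have "s (n + 1) (dif F n (\<alpha> n a)) = \<zero>\<^bsub>obj F n\<^esub>"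
        using d\<alpha>[OF a] mod_hom_zero[OF F(2) F(2) s'] by simp
      ultimately show "w n (\<alpha> n a) = \<alpha> n a"
        using mod_hom_closed[OF \<alpha> a] by (simp add: w_def Fn.a_minus_zero)
    qed (use mod_hom_closed[OF \<alpha> a] a in auto)
    \<comment> \<open>On a boundary \<open>w\<close> is zero, since \<open>p\<close> is the identity
      there and the next differential vanishes.\<close>
    have qd: "q (n + 1) (dif F n x) = \<zero>\<^bsub>obj L (n + 1)\<^esub>" if x: "x \<in> carrier (obj F n)" for n x
    proof (rule q_eq)
      interpret F1: module R "obj F (n + 1)" by (rule F)
      interpret L1: module R "obj L (n + 1)" by (rule L)
      note dx = mod_hom_closed[OF F(3) x]
      show "dif F n x \<in> carrier (obj F (n + 1))" by (rule dx)
      show "\<zero>\<^bsub>obj L (n + 1)\<^esub> \<in> carrier (obj L (n + 1))" by simp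
      have B1: "dif F n x \<in> boundaries F (n + 1)" using x by (auto simp: in_B)
      have "s (n + 1 + 1) (dif F (n + 1) (dif F n x)) = \<zero>\<^bsub>obj F (n + 1)\<^esub>"
        using dB[OF B1] mod_hom_zero[OF F(2) F(2) s'[of "n + 1"]] by simp
      then show "w (n + 1) (dif F n x) = \<alpha> (n + 1) \<zero>\<^bsub>obj L (n + 1)\<^esub>"
        using dx pid[OF B1] by (simp add: w_def mod_hom_zero[OF L(2) F(2) \<alpha>] F1.a_minus_zero F1.minus_eq_zero_iff)
    qed
    \<comment> \<open>Only the \<open>F\<close>-component of \<open>z\<close> enters;
      \<open>q n\<close> lands in \<open>obj L n\<close>, the first summand of the cone in degree
      \<open>n - 1\<close>. For \<open>z = (a, x)\<close> the contraction identity reads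
      \<open>q (\<alpha> a + d x) = a\<close> in the first component and
      \<open>w x + p x + s (d x) = x\<close> in the second, where \<open>s\<close> has killed
      \<open>\<alpha> a\<close>, an element of \<open>G\<close>.\<close>
    define H where "H n z = (q n (snd z), s n (snd z))" for n and z :: "'a \<times> 'b"
    have "H n \<in> mod_hom R (obj ?Z n) (obj ?Z (n - 1))" for n
      by (rule mod_homI)
        (auto simp: H_def Z_obj dsum_module_simps mod_hom_add[OF q] mod_hom_add[OF s]
          mod_hom_smult[OF q] mod_hom_smult[OF s] mod_hom_closed[OF q] mod_hom_closed[OF s])
    moreover have "dif ?Z (n - 1) (H n z) \<oplus>\<^bsub>obj ?Z n\<^esub> H (n + 1) (dif ?Z n z) = z"
      if "z \<in> carrier (obj ?Z n)" for n z
    proof -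
      obtain a x where z: "z = (a, x)" and a: "a \<in> carrier (obj L (n + 1))" and x: "x \<in> carrier (obj F n)"
        using \<open>z \<in> _\<close> by (auto simp: Z_obj dsum_module_simps)
      interpret Fn: module R "obj F n" by (rule F)
      interpret L1: module R "obj L (n + 1)" by (rule L)
      note dx = mod_hom_closed[OF F(3) x] and \<alpha>a = mod_hom_closed[OF \<alpha> a]
      note sdx = mod_hom_closed[OF s' dx]
      have "s (n + 1) (\<alpha> (n + 1) a) = \<zero>\<^bsub>obj F n\<^esub>"
        using s0[of "\<alpha> (n + 1) a" "n + 1"] assms(8) a by auto
      then have "s (n + 1) (\<alpha> (n + 1) a \<oplus>\<^bsub>obj F (n + 1)\<^esub> dif F n x) = s (n + 1) (dif F n x)"
        using sdx by (simp add: mod_hom_add[OF s' \<alpha>a dx])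
      moreover have "q (n + 1) (\<alpha> (n + 1) a \<oplus>\<^bsub>obj F (n + 1)\<^esub> dif F n x) = a"
        using a by (simp add: q_add[OF \<alpha>a dx] q\<alpha> qd[OF x])
      moreover have "w n x \<oplus>\<^bsub>obj F n\<^esub> p n x \<oplus>\<^bsub>obj F n\<^esub> s (n + 1) (dif F n x) = x"
      proof -
        \<comment> \<open>The regrouping sets each term subtracted in \<open>w\<close> beside the
          copy added back, so that both pairs cancel.\<close>
        have "w n x \<oplus>\<^bsub>obj F n\<^esub> p n x \<oplus>\<^bsub>obj F n\<^esub> s (n + 1) (dif F n x) =
          x \<oplus>\<^bsub>obj F n\<^esub> (\<ominus>\<^bsub>obj F n\<^esub> p n x \<oplus>\<^bsub>obj F n\<^esub> p n x) \<oplus>\<^bsub>obj F n\<^esub>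
          (\<ominus>\<^bsub>obj F n\<^esub> s (n + 1) (dif F n x) \<oplus>\<^bsub>obj F n\<^esub> s (n + 1) (dif F n x))"
          using x pc[OF x] sdx by (simp only: w_def a_minus_def Fn.a_ac Fn.a_closed Fn.a_inv_closed)
        then show ?thesis using x pc[OF x] sdx by (simp add: Fn.l_neg)
      qed
      ultimately show ?thesis
        using a by (simp add: z H_def Z_dif[of n] Z_dif' Z_obj dsum_module_simps \<alpha>q[OF x] ds[OF x])
    qed
    ultimately show "homotopy_equiv R ?Z zero_cx"
      unfolding contractible_iff by blast
  qed
qed

end
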